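(* Let $G=(V,E)$ be a finite connected simple graph with $E\ne\varnothing$ and $\operatorname{girth}(G)\ge 6$. Then $\kappa_{\max}^{\mathrm{LLY}}(G)$ is attained by a positive edge weight (i.e. there is $w:E\to(0,\infty)$ with $\kappa_{\mathrm{LLY}}^w(G)=\kappa_{\max}^{\mathrm{LLY}}(G)$) if and only if $G$ is strictly balanced. In that case any weight attaining $\kappa_{\max}^{\mathrm{LLY}}(G)$ is unique up to global scaling (any two such weights differ by a positive constant factor) and has constant Lin--Lu--Yau curvature equal to $\kappa_{\max}^{\mathrm{LLY}}(G)$, i.e. $\kappa_{\mathrm{LLY}}^w(e)=\kappa_{\max}^{\mathrm{LLY}}(G)$ for every $e\in E$.
   Context: Graphs are finite, simple and undirected. $\operatorname{girth}(G)$ is the length of a shortest cycle of $G$, with $\operatorname{girth}(G)=\infty$ if $G$ is a tree. A finite graph $G=(V,E)$ is strictly balanced if $\frac{|E(H)|}{|V(H)|}<\frac{|E|}{|V|}$ for every nonempty proper subgraph $H\subsetneq G$. Lin--Lu--Yau curvature with fixed combinatorial distance: let $G=(V,E)$ be finite and connected with $E\neq\varnothing$, and let $d$ be its combinatorial (shortest-path) distance. A positive edge weight is a function $w:E\to(0,\infty)$; put $d_x^w:=\sum_{z\sim x}w_{xz}$. For $\alpha\in[0,1]$ and $x\in V$ let $\mu_x^{\alpha,w}$ be the probability measure on $V$ with $\mu_x^{\alpha,w}(x)=\alpha$, $\mu_x^{\alpha,w}(z)=(1-\alpha)w_{xz}/d_x^w$ if $z\sim x$, and $\mu_x^{\alpha,w}(z)=0$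 otherwise. Let $W_1$ be the $1$-Wasserstein distance with respect to $d$ (independent of $w$). For an edge $e=xy$, put $\kappa_\alpha^w(x,y):=1-W_1(\mu_x^{\alpha,w},\mu_y^{\alpha,w})$ and $$\kappa_{\mathrm{LLY}}^w(e)=\kappa_{\mathrm{LLY}}^w(x,y):=\lim_{\alpha\to1^-}\frac{\kappa_\alpha^w(x,y)}{1-\alpha}.$$ Put $\kappa_{\mathrm{LLY}}^w(G):=\min_{e\in E}\kappa_{\mathrm{LLY}}^w(e)$ and $\kappa_{\max}^{\mathrm{LLY}}(G):=\sup_{w:E\to(0,\infty)}\kappa_{\mathrm{LLY}}^w(G)$. *)

theory Defs
  imports Complex_Main "HOL-Library.Extended_Nat"
begin

section \<open>Finite simple graphs\<close>

text \<open>A graph is given by its vertex set \<open>V\<close> and its set \<open>E\<close> of edges, an edge being the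
  two-element set of its end points.\<close>

definition simple_graph :: "'a set \<Rightarrow> 'a set set \<Rightarrow> bool" where
  "simple_graph V E \<longleftrightarrow> finite V \<and> (\<forall>e\<in>E. e \<subseteq> V \<and> card e = 2)"

definition walk :: "'a set \<Rightarrow> 'a set set \<Rightarrow> 'a \<Rightarrow> 'a list \<Rightarrow> 'a \<Rightarrow> bool" where
  "walk V E x p y \<longleftrightarrow> p \<noteq> [] \<and> hd p = x \<and> last p = y \<and> set p \<subseteq> V
     \<and> successively (\<lambda>u v. {u, v} \<in> E) p"

definition connected_graph :: "'a set \<Rightarrow> 'a set set \<Rightarrow> bool" where
  "connected_graph V E \<longleftrightarrow> V \<noteq> {} \<and> (\<forall>x\<in>V. \<forall>y\<in>V. \<exists>p. walk V E x p y)"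

text \<open>A walk is recorded by its vertices, so a walk with \<open>n\<close> edges is a list of length \<open>Suc n\<close>.\<close>

definition graph_dist :: "'a set \<Rightarrow> 'a set set \<Rightarrow> 'a \<Rightarrow> 'a \<Rightarrow> nat" where
  "graph_dist V E x y = (LEAST n. \<exists>p. walk V E x p y \<and> length p = Suc n)"

text \<open>A cycle is listed without repeating its first vertex, so its length is that of the list.\<close>

definition graph_cycle :: "'a set \<Rightarrow> 'a set set \<Rightarrow> 'a list \<Rightarrow> bool" where
  "graph_cycle V E c \<longleftrightarrow> 3 \<le> length c \<and> distinct c \<and> set c \<subseteq> V
     \<and> successively (\<lambda>u v. {u, v} \<in> E) c \<and> {last c, hd c} \<in> E"

text \<open>The infimum of the empty set is \<open>\<infinity>\<close>, which is the girth of an acyclic graph.\<close>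

definition girth :: "'a set \<Rightarrow> 'a set set \<Rightarrow> enat" where
  "girth V E = (INF c\<in>{c. graph_cycle V E c}. enat (length c))"

definition strictly_balanced :: "'a set \<Rightarrow> 'a set set \<Rightarrow> bool" where
  "strictly_balanced V E \<longleftrightarrow>
     (\<forall>V' E'. simple_graph V' E' \<and> V' \<subseteq> V \<and> E' \<subseteq> E \<and> V' \<noteq> {} \<and> (V', E') \<noteq> (V, E) \<longrightarrow>
        real (card E') / real (card V') < real (card E) / real (card V))"

section \<open>Lin--Lu--Yau curvature of an edge weight\<close>

text \<open>Only the values on \<open>E\<close> of a weight are relevant.\<close>

definition positive_weight :: "'a set set \<Rightarrow> ('a set \<Rightarrow> real) \<Rightarrow> bool" where
  "positive_weight E w \<longleftrightarrow> (\<forall>e\<in>E. 0 < w e)"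

definition weighted_degree :: "'a set set \<Rightarrow> ('a set \<Rightarrow> real) \<Rightarrow> 'a \<Rightarrow> real" where
  "weighted_degree E w x = (\<Sum>z | {x, z} \<in> E. w {x, z})"

text \<open>Probability measures on the finite set \<open>V\<close> are represented by their mass functions.\<close>

definition lazy_measure :: "'a set set \<Rightarrow> ('a set \<Rightarrow> real) \<Rightarrow> real \<Rightarrow> 'a \<Rightarrow> 'a \<Rightarrow> real" where
  "lazy_measure E w \<alpha> x z =
     (if z = x then \<alpha>
      else if {x, z} \<in> E then (1 - \<alpha>) * w {x, z} / weighted_degree E w x
      else 0)"

definition couplings :: "'a set \<Rightarrow> ('a \<Rightarrow> real) \<Rightarrow> ('a \<Rightarrow> real) \<Rightarrow> ('a \<Rightarrow> 'a \<Rightarrow> real) set" where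
  "couplings V \<mu> \<nu> = {\<pi>. (\<forall>u\<in>V. \<forall>v\<in>V. 0 \<le> \<pi> u v)
     \<and> (\<forall>u\<in>V. (\<Sum>v\<in>V. \<pi> u v) = \<mu> u) \<and> (\<forall>v\<in>V. (\<Sum>u\<in>V. \<pi> u v) = \<nu> v)}"

definition W1 :: "'a set \<Rightarrow> 'a set set \<Rightarrow> ('a \<Rightarrow> real) \<Rightarrow> ('a \<Rightarrow> real) \<Rightarrow> real" where
  "W1 V E \<mu> \<nu> =
     (INF \<pi>\<in>couplings V \<mu> \<nu>. \<Sum>u\<in>V. \<Sum>v\<in>V. real (graph_dist V E u v) * \<pi> u v)"

definition kappa :: "'a set \<Rightarrow> 'a set set \<Rightarrow> ('a set \<Rightarrow> real) \<Rightarrow> real \<Rightarrow> 'a \<Rightarrow> 'a \<Rightarrow> real" where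
  "kappa V E w \<alpha> x y = 1 - W1 V E (lazy_measure E w \<alpha> x) (lazy_measure E w \<alpha> y)"

definition kappa_LLY :: "'a set \<Rightarrow> 'a set set \<Rightarrow> ('a set \<Rightarrow> real) \<Rightarrow> 'a \<Rightarrow> 'a \<Rightarrow> real" where
  "kappa_LLY V E w x y = Lim (at_left 1) (\<lambda>\<alpha>. kappa V E w \<alpha> x y / (1 - \<alpha>))"

text \<open>The curvature is symmetric in the end points, so the curvatures of the edges are the values
  \<open>kappa_LLY V E w x y\<close> over all ordered pairs of adjacent vertices.\<close>

definition kappa_LLY_graph :: "'a set \<Rightarrow> 'a set set \<Rightarrow> ('a set \<Rightarrow> real) \<Rightarrow> real" where
  "kappa_LLY_graph V E w = Min {kappa_LLY V E w x y | x y. {x, y} \<in> E}"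

definition kappa_LLY_max :: "'a set \<Rightarrow> 'a set set \<Rightarrow> real" where
  "kappa_LLY_max V E = (SUP w\<in>{w. positive_weight E w}. kappa_LLY_graph V E w)"

definition attains_max :: "'a set \<Rightarrow> 'a set set \<Rightarrow> ('a set \<Rightarrow> real) \<Rightarrow> bool" where
  "attains_max V E w \<longleftrightarrow> positive_weight E w \<and> kappa_LLY_graph V E w = kappa_LLY_max V E"

end

theory Submission
  imports Defs "HOL-Analysis.Function_Topology"
begin

text \<open>In girth at least six the curvature of an edge has a closed form: writing \<open>d\<close> for the weighted
degree,
\<open>\<kappa>(xy) = 2 (w xy / d x + w xy / d y) - 2\<close> (\<open>kappa_LLY_edge\<close>). An explicit transport plan and an
explicit pair of dual potentials certify each other; the girth enters because another neighbour of
\<open>x\<close> and another neighbour of \<open>y\<close> are then at distance exactly three, so that no shortcut beats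
moving all mass through the edge \<open>xy\<close>.

The theorem thus concerns the loads \<open>s e = w e / d x + w e / d y\<close>, whose smallest value is to be
maximised. Two facts govern them. First, the loads of all edges sum to \<open>|V|\<close>, since each vertex
distributes a total of one among its edges; over a proper nonempty subset \<open>F\<close> of a connected graph
the sum is strictly below the number of vertices that \<open>F\<close> touches. Second, multiplying the weights
on a set \<open>F\<close> by a factor \<open>r > 1\<close> lowers no load on \<open>F\<close>, raises strictly those next to an edge
outside \<open>F\<close>, and lowers the other ones by a factor at most \<open>r\<close> (\<open>load_scaled_ge\<close>).

The second fact, applied to the set of edges of minimal load, shows that a weight with maximal minimum
has constant load (\<open>min_load_maximizer_constant\<close>); the constant is then \<open>|V| / |E|\<close>, which is in any
case an upper bound for the minimal load. So attaining the maximum means having constant load. The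
first fact, applied to such a weight, gives \<open>|F| |V| < |V(F)| |E|\<close> for every proper nonempty \<open>F\<close>,
which is strict balance. Uniqueness follows from the second fact as well, applied to the set of edges
on which the ratio of two weights of constant load is largest (\<open>constant_load_unique\<close>).

It remains to produce a weight of constant load on a strictly balanced graph (\<open>constant_load_exists\<close>).
Such weights are the critical points of \<open>\<Sum>v. ln (d v) - |V| / |E| * (\<Sum>e. ln (w e))\<close>, a convex function
of the numbers \<open>ln (w e)\<close>. It is minimised over a box \<open>[a, 1]\<close>. At the minimum the load is at most
\<open>|V| / |E|\<close> on each edge with \<open>w e > a\<close> and at least \<open>|V| / |E|\<close> on each edge with \<open>w e < 1\<close>. If the
weight avoids one end of the box, one of these bounds holds on all edges, and the known sum of the
loads turns it into equality. If the weight meets both ends and \<open>a\<close> is small, then a large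
multiplicative gap separates heavy from light edges. The heavy edges \<open>F\<close> then use up almost
everything at the vertices they touch, so that their loads sum to nearly \<open>|V(F)|\<close>, yet to at most
\<open>|F| |V| / |E|\<close>. This contradicts strict balance.\<close>

section \<open>Loads of weighted edges\<close>

text \<open>For \<open>F\<close> the set of all edges this is the weighted degree; for smaller \<open>F\<close> it is the part of the
degree contributed by \<open>F\<close>.\<close>

definition incident_weight :: "'a set set \<Rightarrow> ('a set \<Rightarrow> real) \<Rightarrow> 'a \<Rightarrow> real" where
  "incident_weight F w x = (\<Sum>e\<in>{e \<in> F. x \<in> e}. w e)"

text \<open>Each vertex splits one unit among its edges in proportion to their weights; the load is the amount that
an edge receives.\<close>

definition load :: "'a set set \<Rightarrow> ('a set \<Rightarrow> real) \<Rightarrow> 'a set \<Rightarrow> real" where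
  "load E w e = (\<Sum>x\<in>e. w e / incident_weight E w x)"

definition min_load :: "'a set set \<Rightarrow> ('a set \<Rightarrow> real) \<Rightarrow> real" where
  "min_load E w = Min (load E w ` E)"

text \<open>Loads are defined through incidences, and edges are taken to be arbitrary finite nonempty sets.
Connectedness is used in the form that every proper nonempty set of edges shares a vertex with its
complement.\<close>

locale connected_hypergraph =
  fixes E :: "'a set set"
  assumes finite_edges: "finite E"
    and edges_nonempty: "E \<noteq> {}"
    and finite_edge: "e \<in> E \<Longrightarrow> finite e"
    and edge_nonempty: "e \<in> E \<Longrightarrow> e \<noteq> {}"
    and crossing: "\<lbrakk>F \<subseteq> E; F \<noteq> {}; F \<noteq> E\<rbrakk> \<Longrightarrow> \<exists>e\<in>F. \<exists>f\<in>E - F. e \<inter> f \<noteq> {}"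
begin

lemma finite_vertices: "F \<subseteq> E \<Longrightarrow> finite (\<Union>F)"
  using finite_edges finite_edge by (meson finite_Union finite_subset subsetD)

lemma finite_star: "F \<subseteq> E \<Longrightarrow> finite {e \<in> F. x \<in> e}"
  using finite_edges by (auto intro: finite_subset)

lemma card_vertices_pos: "\<lbrakk>F \<subseteq> E; F \<noteq> {}\<rbrakk> \<Longrightarrow> 0 < card (\<Union>F)"
  using finite_vertices edge_nonempty by (fastforce simp: card_gt_0_iff)

lemma card_edges_pos: "0 < card E"
  using finite_edges edges_nonempty by (simp add: card_gt_0_iff)

lemma incident_weight_pos:
  assumes "positive_weight E w" "x \<in> e" "e \<in> E"
  shows "0 < incident_weight E w x"
  unfolding incident_weight_def
  by (rule sum_pos) (use assms finite_star[of E] in \<open>auto simp: positive_weight_def\<close>)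

lemma load_pos:
  assumes "positive_weight E w" "e \<in> E"
  shows "0 < load E w e"
  unfolding load_def
  by (rule sum_pos)
    (use assms finite_edge edge_nonempty incident_weight_pos in
      \<open>auto simp: positive_weight_def\<close>)

text \<open>Double counting: the contributions to the loads are grouped by the vertex that makes them.\<close>

lemma sum_load:
  assumes "F \<subseteq> E"
  shows "(\<Sum>e\<in>F. load E w e) = (\<Sum>x\<in>\<Union>F. incident_weight F w x / incident_weight E w x)"
proof -
  have "(\<Sum>e\<in>F. load E w e) = (\<Sum>e\<in>F. \<Sum>x\<in>{x \<in> \<Union>F. x \<in> e}. w e / incident_weight E w x)"
    unfolding load_def by (intro sum.cong) auto
  also have "\<dots> = (\<Sum>x\<in>\<Union>F. \<Sum>e\<in>{e \<in> F. x \<in> e}. w e / incident_weight E w x)"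
    by (rule sum.swap_restrict)
      (use assms finite_edges finite_vertices in \<open>auto intro: finite_subset\<close>)
  also have "\<dots> = (\<Sum>x\<in>\<Union>F. incident_weight F w x / incident_weight E w x)"
    by (simp add: incident_weight_def sum_divide_distrib)
  finally show ?thesis .
qed

lemma sum_load_eq_card:
  assumes "positive_weight E w"
  shows "(\<Sum>e\<in>E. load E w e) = card (\<Union>E)"
proof -
  have "incident_weight E w x / incident_weight E w x = 1" if "x \<in> \<Union>E" for x
    using that incident_weight_pos[OF assms] by fastforce
  then show ?thesis
    by (simp add: sum_load)
qed

lemma incident_weight_mono:
  assumes "positive_weight E w" "F \<subseteq> E"
  shows "incident_weight F w x \<le> incident_weight E w x"
  unfolding incident_weight_def
  by (rule sum_mono2)
    (use assms finite_star[of E] in \<open>auto simp: positive_weight_def less_imp_le\<close>)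

text \<open>Each vertex of \<open>F\<close> contributes at most one, and a vertex shared with an edge outside \<open>F\<close> gives away
part of its total to that edge.\<close>

lemma sum_load_less_card:
  assumes w: "positive_weight E w" and F: "F \<subseteq> E" "F \<noteq> {}" "F \<noteq> E"
  shows "(\<Sum>e\<in>F. load E w e) < card (\<Union>F)"
proof -
  have le: "incident_weight F w x / incident_weight E w x \<le> 1" if "x \<in> \<Union>F" for x
  proof -
    obtain e where "x \<in> e" "e \<in> F"
      using \<open>x \<in> \<Union>F\<close> by (rule UnionE)
    then have "0 < incident_weight E w x"
      using incident_weight_pos[OF w] F(1) by (metis subsetD)
    then show ?thesis
      using incident_weight_mono[OF w F(1)] by (metis divide_le_eq_1_pos)
  qed
  obtain e f x where x: "e \<in> F" "f \<in> E - F" "x \<in> e" "x \<in> f"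
    using crossing[OF F] by blast
  have "incident_weight F w x < incident_weight E w x"
    unfolding incident_weight_def
  proof (rule sum_strict_mono2[where b = f])
    show "finite {e \<in> E. x \<in> e}"
      by (simp add: finite_star)
    show "0 < w f" "\<And>e. e \<in> {e \<in> E. x \<in> e} \<Longrightarrow> 0 \<le> w e"
      using x w by (auto simp: positive_weight_def less_imp_le)
  qed (use x F(1) in auto)
  then have "incident_weight F w x / incident_weight E w x < 1"
    using incident_weight_pos[OF w, of x e] x F(1) by (simp add: divide_less_eq_1_pos subsetD)
  then have "(\<Sum>x\<in>\<Union>F. incident_weight F w x / incident_weight E w x) < (\<Sum>x\<in>\<Union>F. 1)"
    using le finite_vertices[OF F(1)] UnionI[OF x(1,3)] by (intro sum_strict_mono_ex1) blast+
  then show ?thesis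
    by (simp add: sum_load[OF F(1)])
qed

lemma constant_load_eq:
  assumes "positive_weight E w" "\<And>e. e \<in> E \<Longrightarrow> load E w e = c"
  shows "c = card (\<Union>E) / card E"
proof -
  have "card E * c = card (\<Union>E)"
    using sum_load_eq_card[OF assms(1)] assms(2) by simp
  then show ?thesis
    using card_edges_pos by (simp add: field_simps)
qed

lemma min_load_le:
  assumes "positive_weight E w"
  shows "min_load E w \<le> card (\<Union>E) / card E"
proof -
  have "(\<Sum>e\<in>E. min_load E w) \<le> (\<Sum>e\<in>E. load E w e)"
    unfolding min_load_def by (rule sum_mono) (simp add: finite_edges)
  then show ?thesis
    using sum_load_eq_card[OF assms] card_edges_pos by (simp add: field_simps)
qed

section \<open>Weights with maximal smallest load\<close>

text \<open>If no weight grows by more than the factor \<open>r\<close>, no degree does. An edge whose weight grows by the full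
factor \<open>r\<close> therefore keeps at least its load, and it gains strictly if a neighbouring edge falls short
of the factor. The quotient \<open>w' e / (r * w e)\<close> measures by how much the edge \<open>e\<close> itself falls short.\<close>

lemma load_scaled_ge:
  assumes w: "positive_weight E w" and w': "positive_weight E w'"
    and le: "\<And>f. f \<in> E \<Longrightarrow> w' f \<le> r * w f" and e: "e \<in> E" and r: "0 < r"
  shows "w' e / (r * w e) * load E w e \<le> load E w' e" (is ?weak)
    and "\<lbrakk>f \<in> E; e \<inter> f \<noteq> {}; w' f < r * w f\<rbrakk> \<Longrightarrow> w' e / (r * w e) * load E w e < load E w' e"
proof -
  have pos: "0 < w e" "0 < w' e"
    using w w' e by (auto simp: positive_weight_def)
  have deg_le: "incident_weight E w' x \<le> r * incident_weight E w x" for x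
    unfolding incident_weight_def sum_distrib_left by (rule sum_mono) (use le in auto)
  have dpos: "0 < incident_weight E w x" "0 < incident_weight E w' x" if "x \<in> e" for x
    using incident_weight_pos w w' e that by auto
  have expand: "w' e / (r * w e) * load E w e
      = (\<Sum>x\<in>e. w' e / (r * incident_weight E w x))"
    unfolding load_def sum_distrib_left using pos by (intro sum.cong) auto
  have term_le: "w' e / (r * incident_weight E w x) \<le> w' e / incident_weight E w' x"
    if "x \<in> e" for x
    using deg_le[of x] dpos[OF that] pos by (intro divide_left_mono) auto
  show ?weak
    unfolding expand load_def[of E w'] by (rule sum_mono) (rule term_le)
  assume f: "f \<in> E" "e \<inter> f \<noteq> {}" "w' f < r * w f"
  then obtain x where x: "x \<in> e" "x \<in> f"
    by auto
  have "incident_weight E w' x < r * incident_weight E w x"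
    unfolding incident_weight_def sum_distrib_left
    by (rule sum_strict_mono_ex1) (use le f x finite_star[of E] in auto)
  then have "w' e / (r * incident_weight E w x) < w' e / incident_weight E w' x"
    using dpos[OF x(1)] pos r by (intro divide_strict_left_mono) auto
  then show "w' e / (r * w e) * load E w e < load E w' e"
    unfolding expand load_def[of E w'] using x finite_edge[OF e] term_le
    by (intro sum_strict_mono_ex1) auto
qed

text \<open>The edges of minimal load are multiplied by a factor \<open>r\<close> slightly larger than one. This lowers none of
their loads, and it raises the load of one that meets an edge outside of the set. The remaining edges
lose a factor of at most \<open>r\<close>, which keeps them above the old minimum as long as \<open>r\<close> is smaller than the
quotient \<open>\<tau> / \<sigma>\<close> of the second smallest load and the smallest one.\<close>

lemma shrink_min_set:
  assumes w: "positive_weight E w" and notall: "\<not> (\<forall>e\<in>E. load E w e = min_load E w)"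
  obtains w' where "positive_weight E w'"
    "\<forall>e\<in>E. min_load E w \<le> load E w' e"
    "{e \<in> E. load E w' e = min_load E w} \<subset> {e \<in> E. load E w e = min_load E w}"
proof -
  define \<sigma> where "\<sigma> = min_load E w"
  define M where "M = {e \<in> E. load E w e = \<sigma>}"
  have \<sigma>_le: "\<sigma> \<le> load E w e" if "e \<in> E" for e
    using that finite_edges by (simp add: \<sigma>_def min_load_def)
  have "\<sigma> \<in> load E w ` E"
    unfolding \<sigma>_def min_load_def using finite_edges edges_nonempty by (intro Min_in) auto
  then have M: "M \<subseteq> E" "M \<noteq> {}" "M \<noteq> E" and \<sigma>: "0 < \<sigma>"
    using notall load_pos[OF w] by (auto simp: M_def \<sigma>_def[symmetric])
  define \<tau> where "\<tau> = Min (load E w ` (E - M))"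
  have "\<tau> \<in> load E w ` (E - M)"
    unfolding \<tau>_def using finite_edges M by (intro Min_in) auto
  then have "\<sigma> < \<tau>"
    using \<sigma>_le by (force simp: M_def)
  then obtain r where r: "1 < r" "r < \<tau> / \<sigma>"
    using \<sigma> dense[of 1 "\<tau> / \<sigma>"] by auto
  define w' where "w' = (\<lambda>e. if e \<in> M then r * w e else w e)"
  have w': "positive_weight E w'"
    using w r by (simp add: w'_def positive_weight_def)
  have le: "w' f \<le> r * w f" if "f \<in> E" for f
    using w r that by (auto simp: w'_def positive_weight_def less_imp_le)
  note scaled = load_scaled_ge[OF w w' le]
  have wne: "w e \<noteq> 0" if "e \<in> E" for e
    using w that by (force simp: positive_weight_def)
  have one: "w' e / (r * w e) = 1" if "e \<in> M" for e
    using that wne[of e] r M by (auto simp: w'_def)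
  have inM: "\<sigma> \<le> load E w' e" if "e \<in> M" for e
    using scaled(1)[of e, unfolded one[OF that]] that M(1) r by (auto simp: M_def)
  have notM: "\<sigma> < load E w' e" if "e \<in> E" "e \<notin> M" for e
  proof -
    have "load E w e / r \<le> load E w' e"
      using scaled(1)[of e] wne[of e] that r by (auto simp: w'_def)
    then have "load E w e \<le> r * load E w' e"
      using r by (simp add: pos_divide_le_eq mult.commute)
    moreover have "\<tau> \<le> load E w e"
      unfolding \<tau>_def using that finite_edges by simp
    moreover have "r * \<sigma> < \<tau>"
      using r \<sigma> by (simp add: pos_less_divide_eq)
    ultimately have "r * \<sigma> < r * load E w' e"
      by linarith
    then show ?thesis
      using r by simp
  qed
  obtain e f where ef: "e \<in> M" "f \<in> E - M" "e \<inter> f \<noteq> {}"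
    using crossing[OF M] by blast
  have "w' f < r * w f"
    using ef w r by (auto simp: w'_def positive_weight_def)
  then have "\<sigma> < load E w' e"
    using scaled(2)[of e f, unfolded one[OF ef(1)]] ef M(1) r by (auto simp: M_def)
  then have "{e \<in> E. load E w' e = \<sigma>} \<subset> M"
    using ef M notM by fastforce
  moreover have "\<forall>e\<in>E. \<sigma> \<le> load E w' e"
    using inM notM less_imp_le by blast
  ultimately show ?thesis
    using that[OF w'] by (simp add: M_def \<sigma>_def)
qed

text \<open>A maximizer with nonconstant load could be modified repeatedly by the preceding lemma. Each new weight
is again a maximizer, with a smaller set of edges of minimal load; this cannot go on forever.\<close>

lemma min_load_maximizer_constant:
  assumes "positive_weight E w"
    and "\<And>w'. positive_weight E w' \<Longrightarrow> min_load E w' \<le> min_load E w"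
    and "e \<in> E"
  shows "load E w e = min_load E w"
proof -
  have "\<forall>e\<in>E. load E w e = min_load E w"
    using assms(1,2)
  proof (induction "card {e \<in> E. load E w e = min_load E w}" arbitrary: w rule: less_induct)
    case less
    show ?case
    proof (rule ccontr)
      assume notall: "\<not> (\<forall>e\<in>E. load E w e = min_load E w)"
      obtain w' where w': "positive_weight E w'"
          "\<forall>e\<in>E. min_load E w \<le> load E w' e"
          "{e \<in> E. load E w' e = min_load E w} \<subset> {e \<in> E. load E w e = min_load E w}"
        using shrink_min_set[OF less.prems(1) notall] by blast
      have "min_load E w \<le> min_load E w'"
        unfolding min_load_def[of E w'] using w'(2) finite_edges edges_nonempty by simp
      then have eq: "min_load E w' = min_load E w"
        using less.prems(2)[OF w'(1)] by simp
      have card_less: "card {e \<in> E. load E w' e = min_load E w'}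
          < card {e \<in> E. load E w e = min_load E w}"
        unfolding eq using w'(3) finite_edges by (intro psubset_card_mono) auto
      have "\<forall>e\<in>E. load E w' e = min_load E w'"
        by (rule less.hyps[OF card_less w'(1)]) (simp add: eq less.prems(2))
      then have "\<forall>e\<in>E. load E w' e = min_load E w"
        unfolding eq .
      then have "{e \<in> E. load E w' e = min_load E w} = E"
        by auto
      then show False
        using w'(3) by auto
    qed
  qed
  then show ?thesis
    using assms(3) by blast
qed

lemma min_load_maximizer_iff:
  assumes w: "positive_weight E w"
  shows "(\<forall>w'. positive_weight E w' \<longrightarrow> min_load E w' \<le> min_load E w)
    \<longleftrightarrow> (\<forall>e\<in>E. load E w e = card (\<Union>E) / card E)" (is "?max \<longleftrightarrow> ?const")
proof
  assume max: ?max
  have "load E w e = min_load E w" if "e \<in> E" for e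
    using min_load_maximizer_constant[OF w _ that] max by blast
  then show ?const
    using constant_load_eq[OF w] by metis
next
  assume const: ?const
  have "min_load E w \<in> load E w ` E"
    unfolding min_load_def using finite_edges edges_nonempty by (intro Min_in) auto
  then have "min_load E w = card (\<Union>E) / card E"
    using const by auto
  then show ?max
    using min_load_le by simp
qed

lemma balanced_if_constant_load:
  assumes w: "positive_weight E w" and const: "\<And>e. e \<in> E \<Longrightarrow> load E w e = card (\<Union>E) / card E"
    and F: "F \<subseteq> E" "F \<noteq> {}" "F \<noteq> E"
  shows "card (\<Union>E) * card F < card (\<Union>F) * card E"
proof -
  have "(\<Sum>e\<in>F. load E w e) = (\<Sum>e\<in>F. card (\<Union>E) / card E)"
    by (rule sum.cong) (use const F(1) in auto)
  then have "card F * (card (\<Union>E) / card E) < card (\<Union>F)"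
    using sum_load_less_card[OF w F] by simp
  then have "real (card (\<Union>E) * card F) < real (card (\<Union>F) * card E)"
    using card_edges_pos by (simp add: pos_divide_less_eq mult.commute)
  then show ?thesis
    by (simp only: of_nat_less_iff)
qed

text \<open>Let \<open>F\<close> be the set of edges on which \<open>w' / w\<close> attains its largest value \<open>r\<close>. If \<open>F\<close> missed an edge, then
passing from \<open>w\<close> to \<open>w'\<close> would strictly raise the load of an edge of \<open>F\<close> next to a missed one.\<close>

lemma constant_load_unique:
  assumes w: "positive_weight E w" "\<And>e. e \<in> E \<Longrightarrow> load E w e = c"
    and w': "positive_weight E w'" "\<And>e. e \<in> E \<Longrightarrow> load E w' e = c"
  obtains r where "0 < r" "\<And>e. e \<in> E \<Longrightarrow> w' e = r * w e"
proof -
  define r where "r = Max ((\<lambda>e. w' e / w e) ` E)"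
  define F where "F = {e \<in> E. w' e / w e = r}"
  have pos: "0 < w e" "0 < w' e" if "e \<in> E" for e
    using w w' that by (auto simp: positive_weight_def)
  have "r \<in> (\<lambda>e. w' e / w e) ` E"
    unfolding r_def using finite_edges edges_nonempty by (intro Max_in) auto
  then have F: "F \<subseteq> E" "F \<noteq> {}" and r: "0 < r"
    using pos by (auto simp: F_def)
  have ratio: "w' e / w e \<le> r" if "e \<in> E" for e
    unfolding r_def using that finite_edges by simp
  then have le: "w' e \<le> r * w e" if "e \<in> E" for e
    using that pos by (force simp: field_simps)
  have "F = E"
  proof (rule ccontr)
    assume "F \<noteq> E"
    then obtain e f where ef: "e \<in> F" "f \<in> E - F" "e \<inter> f \<noteq> {}"
      using crossing[OF F \<open>F \<noteq> E\<close>] by blast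
    have "w' f / w f < r"
      using ef(2) ratio[of f] by (simp add: F_def less_le)
    then have "w' f < r * w f"
      using pos[of f] ef(2) by (simp add: pos_divide_less_eq)
    moreover have "w' e / (r * w e) = 1"
      using ef(1) r pos[of e] by (auto simp: F_def)
    ultimately have "load E w e < load E w' e"
      using load_scaled_ge(2)[OF w(1) w'(1) le, of e f] ef F(1) r by (metis DiffD1 mult_1 subsetD)
    then show False
      using w(2) w'(2) ef F by auto
  qed
  have "w' e = r * w e" if "e \<in> E" for e
  proof -
    have "w' e / w e = r"
      using that \<open>F = E\<close> unfolding F_def by blast
    then show ?thesis
      using pos(1)[OF that] by (simp add: divide_eq_eq)
  qed
  then show ?thesis
    using that r by blast
qed

end

section \<open>Existence of a weight with constant load\<close>

text \<open>The \<open>m\<close> disjoint intervals can contain at most \<open>m - 1\<close> elements of \<open>A\<close>, because its element one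
lies in none of them.\<close>

lemma geometric_gap:
  fixes A :: "real set"
  assumes A: "finite A" "card A \<le> m" "1 \<in> A" and q: "0 < q" "q < 1"
  obtains i where "i < m" "A \<inter> {q ^ Suc i..<q ^ i} = {}"
proof (rule ccontr)
  assume "\<not> thesis"
  then have "\<forall>i\<in>{..<m}. \<exists>a. a \<in> A \<inter> {q ^ Suc i..<q ^ i}"
    using that by blast
  then obtain g where g: "\<And>i. i < m \<Longrightarrow> g i \<in> A \<inter> {q ^ Suc i..<q ^ i}"
    by (metis lessThan_iff)
  have less: "g j < g i" if "i < j" "j < m" for i j
  proof -
    have "g j < q ^ j"
      using g[of j] that by simp
    also have "q ^ j \<le> q ^ Suc i"
      using that q by (intro power_decreasing) auto
    also have "q ^ Suc i \<le> g i"
      using g[of i] that by simp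
    finally show ?thesis .
  qed
  have "inj_on g {..<m}"
  proof (rule inj_onI)
    fix i j assume "i \<in> {..<m}" "j \<in> {..<m}" "g i = g j"
    then show "i = j"
      using less[of i j] less[of j i] by (cases i j rule: linorder_cases) auto
  qed
  moreover have "g ` {..<m} \<subseteq> A - {1}"
  proof (rule image_subsetI)
    fix i assume "i \<in> {..<m}"
    then have "g i \<in> A" "g i < q ^ i"
      using g[of i] by auto
    moreover have "q ^ i \<le> 1"
      using q by (intro power_le_one) auto
    ultimately show "g i \<in> A - {1}"
      by auto
  qed
  ultimately have "m \<le> card (A - {1})"
    using card_inj_on_le[of g "{..<m}" "A - {1}"] A by simp
  moreover have "card (A - {1}) < card A"
    using A by (intro psubset_card_mono) auto
  ultimately show False
    using A by simp
qed

context connected_hypergraph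
begin

text \<open>Its partial derivative with respect to \<open>ln (w e)\<close> is the load of \<open>e\<close> minus the average load
\<open>card (\<Union>E) / card E\<close>.\<close>

definition potential :: "('a set \<Rightarrow> real) \<Rightarrow> real" where
  "potential w = (\<Sum>x\<in>\<Union>E. ln (incident_weight E w x))
     - card (\<Union>E) / card E * (\<Sum>e\<in>E. ln (w e))"

lemma incident_weight_cong:
  assumes "\<And>e. e \<in> E \<Longrightarrow> w e = w' e"
  shows "incident_weight E w x = incident_weight E w' x"
  unfolding incident_weight_def using assms by (intro sum.cong) auto

lemma potential_cong:
  assumes "\<And>e. e \<in> E \<Longrightarrow> w e = w' e"
  shows "potential w = potential w'"
  using assms by (simp add: potential_def incident_weight_cong[of w w'])

text \<open>Once the values of \<open>w\<close> outside \<open>E\<close> are fixed to be one, the box is a product of compact intervals and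
hence a compact set of functions.\<close>

lemma potential_minimizer:
  assumes a: "0 < a" "a \<le> 1"
  obtains w where "\<forall>e\<in>E. w e \<in> {a..1}"
    "\<And>w'. \<forall>e\<in>E. w' e \<in> {a..1} \<Longrightarrow> potential w \<le> potential w'"
proof -
  define S where "S = PiE UNIV (\<lambda>e. if e \<in> E then {a..1} else {1::real})"
  have inS: "w e \<in> {a..1}" if "w \<in> S" "e \<in> E" for w e
    using PiE_mem[OF that(1)[unfolded S_def] UNIV_I, of e] that(2) by simp
  have "compactin (product_topology (\<lambda>_. euclidean) UNIV) S"
    unfolding S_def by (auto simp: compactin_PiE)
  then have compact: "compact S"
    by (simp add: euclidean_product_topology)
  have "(\<lambda>_. 1) \<in> S"
    using a by (simp add: S_def PiE_iff)
  then have nonempty: "S \<noteq> {}"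
    by blast
  have coordinate: "continuous_on S (\<lambda>w. w e)" for e
    by (rule continuous_on_subset[OF continuous_on_product_coordinates]) simp
  have cont: "continuous_on S potential"
    unfolding potential_def
  proof (intro continuous_on_diff continuous_on_sum continuous_on_ln continuous_on_mult
      continuous_on_const ballI)
    fix x w assume x: "x \<in> \<Union>E" and w: "w \<in> S"
    have "positive_weight E w"
      using inS[OF w] a by (fastforce simp: positive_weight_def)
    then show "incident_weight E w x \<noteq> 0"
      using x incident_weight_pos by (metis UnionE less_irrefl)
  next
    fix e w assume "e \<in> E" "w \<in> S"
    then show "w e \<noteq> 0"
      using inS[of w e] a by auto
  next
    fix x show "continuous_on S (\<lambda>w. incident_weight E w x)"
      unfolding incident_weight_def by (intro continuous_on_sum coordinate)
  qed (rule coordinate)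
  obtain w where w: "w \<in> S" "\<forall>w'\<in>S. potential w \<le> potential w'"
    using continuous_attains_inf[OF compact nonempty cont] by blast
  have "potential w \<le> potential w'" if w': "\<forall>e\<in>E. w' e \<in> {a..1}" for w'
  proof -
    have "(\<lambda>e. if e \<in> E then w' e else 1) \<in> S"
      using w' by (simp add: S_def PiE_iff)
    then have "potential w \<le> potential (\<lambda>e. if e \<in> E then w' e else 1)"
      using w(2) by blast
    also have "\<dots> = potential w'"
      by (rule potential_cong) simp
    finally show ?thesis .
  qed
  then show ?thesis
    using that[of w] inS[OF w(1)] by blast
qed

text \<open>This upper bound on the change of the potential stands in for its partial derivative, since only one
coordinate is moved. It comes from \<open>ln r \<le> r - 1\<close>, applied to the ratio by which the degree of each
end point changes.\<close>

lemma potential_rescale_edge_le: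
  assumes w: "positive_weight E w" and e: "e \<in> E" and t: "0 < t"
  shows "potential (w(e := t * w e)) - potential w
    \<le> (t - 1) * load E w e - card (\<Union>E) / card E * ln t"
proof -
  define w' where "w' = w(e := t * w e)"
  have w': "positive_weight E w'"
    using w e t by (simp add: w'_def positive_weight_def)
  have we: "0 < w e"
    using w e by (simp add: positive_weight_def)
  have deg: "incident_weight E w' x
      = incident_weight E w x + (if x \<in> e then (t - 1) * w e else 0)" for x
  proof -
    have "incident_weight E w' x
      = (\<Sum>f\<in>{f \<in> E. x \<in> f}. w f + (if f = e then (t - 1) * w e else 0))"
      unfolding incident_weight_def
      by (rule sum.cong) (auto simp: w'_def algebra_simps)
    also have "\<dots> = incident_weight E w x + (if x \<in> e then (t - 1) * w e else 0)"
      unfolding incident_weight_def sum.distrib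
      using e by (simp add: sum.delta[OF finite_star])
    finally show ?thesis .
  qed
  have ln_deg: "ln (incident_weight E w' x) - ln (incident_weight E w x)
      \<le> (if x \<in> e then (t - 1) * w e / incident_weight E w x else 0)" if x: "x \<in> \<Union>E" for x
  proof -
    have pos: "0 < incident_weight E w x" "0 < incident_weight E w' x"
      using x incident_weight_pos w w' by (metis UnionE)+
    then have "ln (incident_weight E w' x) - ln (incident_weight E w x)
        = ln (incident_weight E w' x / incident_weight E w x)"
      by (simp add: ln_div)
    also have "\<dots> \<le> incident_weight E w' x / incident_weight E w x - 1"
      using pos by (intro ln_le_minus_one) simp
    also have "\<dots> = (if x \<in> e then (t - 1) * w e / incident_weight E w x else 0)"
      using pos(1) by (simp add: deg add_divide_distrib)
    finally show ?thesis .
  qed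
  have "(\<Sum>x\<in>\<Union>E. ln (incident_weight E w' x)) - (\<Sum>x\<in>\<Union>E. ln (incident_weight E w x))
      \<le> (\<Sum>x\<in>\<Union>E. if x \<in> e then (t - 1) * w e / incident_weight E w x else 0)"
    unfolding sum_subtractf[symmetric] by (rule sum_mono) (rule ln_deg)
  also have "\<dots> = (\<Sum>x\<in>e. (t - 1) * w e / incident_weight E w x)"
  proof -
    have "\<Union>E \<inter> e = e"
      using e by auto
    then show ?thesis
      by (simp flip: sum.inter_restrict[OF finite_vertices[OF order_refl]])
  qed
  also have "\<dots> = (t - 1) * load E w e"
    by (simp add: load_def sum_distrib_left)
  finally have vertex: "(\<Sum>x\<in>\<Union>E. ln (incident_weight E w' x))
      - (\<Sum>x\<in>\<Union>E. ln (incident_weight E w x)) \<le> (t - 1) * load E w e" .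
  have "(\<Sum>f\<in>E. ln (w' f)) = (\<Sum>f\<in>E. ln (w f) + (if f = e then ln t else 0))"
    by (rule sum.cong) (use we t in \<open>auto simp: w'_def ln_mult\<close>)
  also have "\<dots> = (\<Sum>f\<in>E. ln (w f)) + ln t"
    using e finite_edges by (simp add: sum.distrib)
  finally show ?thesis
    using vertex unfolding w'_def[symmetric] potential_def by (simp add: distrib_left)
qed

text \<open>First-order conditions at a minimum over the box: the weight of an edge can be decreased unless it is
\<open>a\<close>, and increased unless it is one.\<close>

lemma box_minimizer_load:
  assumes a: "0 < a" and w: "\<forall>e\<in>E. w e \<in> {a..1}"
    and min: "\<And>w'. \<forall>e\<in>E. w' e \<in> {a..1} \<Longrightarrow> potential w \<le> potential w'"
    and e: "e \<in> E"
  shows "a < w e \<Longrightarrow> load E w e \<le> card (\<Union>E) / card E"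
    and "w e < 1 \<Longrightarrow> card (\<Union>E) / card E \<le> load E w e"
proof -
  define \<rho> where "\<rho> = card (\<Union>E) / card E"
  define s where "s = load E w e"
  have \<rho>: "0 < \<rho>"
    using card_vertices_pos[of E] card_edges_pos edges_nonempty by (simp add: \<rho>_def)
  have pw: "positive_weight E w"
    using w a by (force simp: positive_weight_def)
  have s: "0 < s" and we: "0 < w e"
    using load_pos[OF pw e] pw e by (auto simp: s_def positive_weight_def)
  \<comment> \<open>Every admissible factor \<open>t\<close> gives this inequality, by \<open>1 - 1 / t \<le> ln t\<close>. Letting \<open>t\<close> tend to
one from below or from above yields the two claims.\<close>
  have ineq: "0 \<le> (t - 1) * (s - \<rho> / t)" if t: "0 < t" "a \<le> t * w e" "t * w e \<le> 1" for t
  proof -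
    have "potential w \<le> potential (w(e := t * w e))"
      using w t by (intro min) auto
    then have "\<rho> * ln t \<le> (t - 1) * s"
      using potential_rescale_edge_le[OF pw e t(1)] by (simp add: \<rho>_def s_def)
    moreover have "- ln t \<le> 1 / t - 1"
      using ln_le_minus_one[of "1 / t"] t(1) by (simp add: ln_div)
    then have "\<rho> * (1 - 1 / t) \<le> \<rho> * ln t"
      using \<rho> by (intro mult_left_mono) auto
    ultimately have "0 \<le> (t - 1) * s - \<rho> * (1 - 1 / t)"
      by linarith
    also have "\<dots> = (t - 1) * (s - \<rho> / t)"
      using t(1) by (simp add: field_simps)
    finally show ?thesis .
  qed
  show "load E w e \<le> card (\<Union>E) / card E" if "a < w e"
    unfolding s_def[symmetric] \<rho>_def[symmetric]
  proof (rule ccontr)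
    assume "\<not> s \<le> \<rho>"
    then have "max (a / w e) (\<rho> / s) < 1"
      using that we s by simp
    then obtain t where t: "max (a / w e) (\<rho> / s) < t" "t < 1"
      using dense by blast
    then have t': "a / w e < t" "\<rho> / s < t"
      by simp_all
    have "0 < t"
      using t'(1) a we by (meson divide_pos_pos less_trans)
    moreover have "a < t * w e"
      using t'(1) we by (simp add: pos_divide_less_eq)
    moreover have "t * w e \<le> 1"
      using t(2) w e we \<open>0 < t\<close> by (intro mult_le_one) auto
    ultimately have "0 \<le> (t - 1) * (s - \<rho> / t)"
      by (intro ineq) auto
    moreover have "\<rho> / t < s"
      using t'(2) s \<open>0 < t\<close> by (simp add: field_simps)
    ultimately show False
      using t(2) by (simp add: zero_le_mult_iff)
  qed
  show "card (\<Union>E) / card E \<le> load E w e" if "w e < 1"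
    unfolding s_def[symmetric] \<rho>_def[symmetric]
  proof (rule ccontr)
    assume "\<not> \<rho> \<le> s"
    then have "1 < min (1 / w e) (\<rho> / s)"
      using that we s by simp
    then obtain t where t: "1 < t" "t < min (1 / w e) (\<rho> / s)"
      using dense by blast
    then have t': "t < 1 / w e" "t < \<rho> / s"
      by simp_all
    have "t * w e < 1"
      using t'(1) we by (simp add: pos_less_divide_eq)
    moreover have "a \<le> t * w e"
    proof -
      have "a \<le> w e"
        using w e by simp
      also have "w e \<le> t * w e"
        using t(1) we by simp
      finally show ?thesis .
    qed
    ultimately have "0 \<le> (t - 1) * (s - \<rho> / t)"
      using t(1) by (intro ineq) auto
    moreover have "s < \<rho> / t"
      using t'(2) t(1) s by (simp add: field_simps)
    ultimately show False
      using t(1) by (simp add: zero_le_mult_iff)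
  qed
qed

text \<open>The loads have average \<open>card (\<Union>E) / card E\<close>, so a one-sided bound by the average is an equality.\<close>

lemma constant_load_if_all_le:
  assumes w: "positive_weight E w"
    and le: "(\<forall>e\<in>E. load E w e \<le> card (\<Union>E) / card E) \<or> (\<forall>e\<in>E. card (\<Union>E) / card E \<le> load E w e)"
    and e: "e \<in> E"
  shows "load E w e = card (\<Union>E) / card E"
proof -
  have eq: "(\<Sum>e\<in>E. load E w e) = (\<Sum>e\<in>E. card (\<Union>E) / card E)"
    using sum_load_eq_card[OF w] card_edges_pos by simp
  show ?thesis
    using le
  proof
    assume "\<forall>e\<in>E. load E w e \<le> card (\<Union>E) / card E"
    then show ?thesis
      using sum_mono_inv[OF eq _ e finite_edges] by blast
  next
    assume "\<forall>e\<in>E. card (\<Union>E) / card E \<le> load E w e"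
    then show ?thesis
      using sum_mono_inv[OF eq[symmetric] _ e finite_edges] by fastforce
  qed
qed

text \<open>At a vertex of \<open>F\<close> the degree is at least \<open>c\<close>, while the edges outside \<open>F\<close> contribute at most
\<open>card E * c * q\<close> to it. The edges of \<open>F\<close> thus account for all but a fraction \<open>card E * q\<close> of the degree.\<close>

lemma sum_load_ge_of_gap:
  fixes c q :: real
  assumes w: "positive_weight E w" and F: "F \<subseteq> E" and c: "0 < c"
    and heavy: "\<And>e. e \<in> F \<Longrightarrow> c \<le> w e" and light: "\<And>e. e \<in> E - F \<Longrightarrow> w e \<le> c * q"
    and q: "0 \<le> q"
  shows "card (\<Union>F) * (1 - card E * q) \<le> (\<Sum>e\<in>F. load E w e)"
proof -
  have "1 - card E * q \<le> incident_weight F w x / incident_weight E w x" if "x \<in> \<Union>F" for x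
  proof -
    obtain e where e: "x \<in> e" "e \<in> F"
      using \<open>x \<in> \<Union>F\<close> by (rule UnionE)
    have eE: "e \<in> E"
      using e(2) F by (rule rev_subsetD)
    have d: "0 < incident_weight E w x"
      by (rule incident_weight_pos[OF w e(1) eE])
    have "c \<le> w e"
      by (rule heavy[OF e(2)])
    also have "w e \<le> incident_weight E w x"
      unfolding incident_weight_def
      by (rule member_le_sum)
        (use e eE w finite_star in \<open>auto simp: positive_weight_def less_imp_le\<close>)
    finally have cd: "c \<le> incident_weight E w x" .
    have split: "{e \<in> E. x \<in> e} = {e \<in> F. x \<in> e} \<union> {e \<in> E - F. x \<in> e}"
      using F by blast
    have "incident_weight E w x = incident_weight F w x + incident_weight (E - F) w x"
      unfolding incident_weight_def split
      by (rule sum.union_disjoint) (use finite_star[OF F] finite_star[of "E - F"] in auto)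
    moreover have "incident_weight (E - F) w x \<le> card E * q * incident_weight E w x"
    proof -
      have "incident_weight (E - F) w x \<le> card {e \<in> E - F. x \<in> e} * (c * q)"
        unfolding incident_weight_def
        by (rule sum_bounded_above) (use light in auto)
      also have "\<dots> \<le> card E * (c * q)"
        using c q finite_edges by (intro mult_right_mono) (auto intro: card_mono)
      also have "\<dots> \<le> card E * (incident_weight E w x * q)"
        using cd q by (intro mult_left_mono mult_right_mono) auto
      finally show ?thesis
        by (simp add: mult_ac)
    qed
    ultimately have "(1 - card E * q) * incident_weight E w x \<le> incident_weight F w x"
      by (simp add: left_diff_distrib)
    then show ?thesis
      using d by (simp add: pos_le_divide_eq)
  qed
  then have "(\<Sum>x\<in>\<Union>F. 1 - card E * q) \<le> (\<Sum>e\<in>F. load E w e)"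
    unfolding sum_load[OF F] by (rule sum_mono)
  then show ?thesis
    by simp
qed

text \<open>The ratio \<open>q\<close> of the gap is chosen so small that the error term in the preceding lemma cannot bridge
the difference between \<open>card (\<Union>F) * card E\<close> and \<open>card (\<Union>E) * card F\<close>, which is at least one as both
are integers. The box has to reach down to \<open>q ^ card E\<close> for a gap to exist.\<close>

lemma constant_load_exists:
  assumes balanced: "\<And>F. \<lbrakk>F \<subseteq> E; F \<noteq> {}; F \<noteq> E\<rbrakk>
      \<Longrightarrow> card (\<Union>E) * card F < card (\<Union>F) * card E"
  obtains w where "positive_weight E w" "\<And>e. e \<in> E \<Longrightarrow> load E w e = card (\<Union>E) / card E"
proof -
  define m n where "m = card E" and "n = card (\<Union>E)"
  have m: "0 < m" and n: "0 < n"
    using card_edges_pos card_vertices_pos[of E] edges_nonempty by (auto simp: m_def n_def)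
  define q where "q = 1 / (real (m * m * n) + 1)"
  have q: "0 < q" "q < 1" and mmnq: "real (m * m * n) * q < 1"
    using m n by (auto simp: q_def field_simps add_pos_nonneg)
  define a where "a = q ^ m"
  have a: "0 < a" "a \<le> 1"
    using q by (auto simp: a_def power_le_one)
  obtain w where w: "\<forall>e\<in>E. w e \<in> {a..1}"
      and min: "\<And>w'. \<forall>e\<in>E. w' e \<in> {a..1} \<Longrightarrow> potential w \<le> potential w'"
    using potential_minimizer[OF a] by blast
  note load_le = box_minimizer_load(1)[OF a(1) w min]
    and load_ge = box_minimizer_load(2)[OF a(1) w min]
  have pw: "positive_weight E w"
    using w a by (force simp: positive_weight_def)
  \<comment> \<open>If the weight takes both extreme values, a gap separates the edges into two nonempty classes.\<close>
  have one_sided: "1 \<notin> w ` E \<or> a \<notin> w ` E"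
  proof (rule ccontr)
    assume "\<not> ?thesis"
    then obtain e0 e1 where e: "e0 \<in> E" "w e0 = a" "e1 \<in> E" "w e1 = 1"
      by auto
    have "finite (w ` E)" "card (w ` E) \<le> m" "1 \<in> w ` E"
      using finite_edges e by (auto simp: m_def card_image_le intro: rev_image_eqI)
    then obtain i where i: "i < m" "w ` E \<inter> {q ^ Suc i..<q ^ i} = {}"
      using geometric_gap[OF _ _ _ q] by metis
    define F where "F = {e \<in> E. q ^ i \<le> w e}"
    have light: "w e \<le> q ^ i * q" if "e \<in> E - F" for e
      using that i(2) by (force simp: F_def mult.commute)
    have aqi: "a < q ^ i"
      unfolding a_def using q i(1) by (intro power_strict_decreasing) auto
    have F: "F \<subseteq> E" "F \<noteq> {}" "F \<noteq> E"
    proof -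
      show "F \<subseteq> E"
        by (auto simp: F_def)
      have "e1 \<in> F"
        using e q by (simp add: F_def power_le_one)
      then show "F \<noteq> {}"
        by blast
      have "e0 \<notin> F"
        using e aqi by (simp add: F_def)
      then show "F \<noteq> E"
        using e by blast
    qed
    have "card (\<Union>F) * (1 - m * q) \<le> (\<Sum>e\<in>F. load E w e)"
      unfolding m_def using q light F(1)
      by (intro sum_load_ge_of_gap[OF pw, where c = "q ^ i"]) (auto simp: F_def)
    also have "\<dots> \<le> (\<Sum>e\<in>F. n / m)"
      unfolding n_def m_def
      using F(1) aqi by (intro sum_mono load_le) (auto simp: F_def)
    finally have "card (\<Union>F) * (1 - m * q) \<le> card F * (n / m)"
      by simp
    then have "m * (card (\<Union>F) * (1 - m * q)) \<le> m * (card F * (n / m))"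
      using m by (intro mult_left_mono) auto
    then have "real (card (\<Union>F) * m) - real (n * card F) \<le> real (m * m * card (\<Union>F)) * q"
      using m by (simp add: algebra_simps)
    also have "\<dots> \<le> real (m * m * n) * q"
    proof (intro mult_right_mono)
      have "card (\<Union>F) \<le> n"
        unfolding n_def using finite_vertices[of E] F(1) by (intro card_mono) auto
      then show "real (m * m * card (\<Union>F)) \<le> real (m * m * n)"
        by (intro of_nat_mono mult_le_mono2)
    qed (use q in simp)
    finally have "real (card (\<Union>F) * m) < real (n * card F + 1)"
      using mmnq by simp
    then have "card (\<Union>F) * m < n * card F + 1"
      by (simp only: of_nat_less_iff)
    then show False
      using balanced[OF F] by (simp add: m_def n_def)
  qed
  have "(\<forall>e\<in>E. load E w e \<le> card (\<Union>E) / card E) \<or> (\<forall>e\<in>E. card (\<Union>E) / card E \<le> load E w e)"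
    using one_sided
  proof
    assume no1: "1 \<notin> w ` E"
    have "w e < 1" if "e \<in> E" for e
      using that w no1 by (metis atLeastAtMost_iff image_eqI less_le)
    then show ?thesis
      using load_ge by blast
  next
    assume noa: "a \<notin> w ` E"
    have "a < w e" if "e \<in> E" for e
      using that w noa by (metis atLeastAtMost_iff image_eqI less_le)
    then show ?thesis
      using load_le by blast
  qed
  then have "load E w e = card (\<Union>E) / card E" if "e \<in> E" for e
    using constant_load_if_all_le[OF pw _ that] by blast
  then show ?thesis
    by (rule that[OF pw])
qed

end

section \<open>Transport costs and complementary slackness\<close>

lemma sum_coupling_potentials:
  assumes V: "finite V" and \<pi>: "\<pi> \<in> couplings V \<mu> \<nu>"
  shows "(\<Sum>u\<in>V. \<Sum>v\<in>V. (F u - G v) * \<pi> u v) = (\<Sum>u\<in>V. F u * \<mu> u) - (\<Sum>v\<in>V. G v * \<nu> v)"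
proof -
  have "(\<Sum>u\<in>V. \<Sum>v\<in>V. (F u - G v) * \<pi> u v)
      = (\<Sum>u\<in>V. \<Sum>v\<in>V. F u * \<pi> u v) - (\<Sum>u\<in>V. \<Sum>v\<in>V. G v * \<pi> u v)"
    by (simp add: left_diff_distrib sum_subtractf)
  also have "(\<Sum>u\<in>V. \<Sum>v\<in>V. G v * \<pi> u v) = (\<Sum>v\<in>V. \<Sum>u\<in>V. G v * \<pi> u v)"
    by (rule sum.swap)
  also have "(\<Sum>u\<in>V. \<Sum>v\<in>V. F u * \<pi> u v) - \<dots> = (\<Sum>u\<in>V. F u * \<mu> u) - (\<Sum>v\<in>V. G v * \<nu> v)"
    using \<pi> by (simp add: couplings_def flip: sum_distrib_left)
  finally show ?thesis .
qed

text \<open>Linear programming duality in the form needed here: a plan and a pair of potentials that are tight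
along the plan are both optimal. The potentials have to respect the distance only between the supports
of the two measures, because a coupling has no mass elsewhere. This spares extending them to
1-Lipschitz functions on the whole graph.\<close>

lemma W1_eq_by_complementary_slackness:
  assumes V: "finite V" and \<pi>: "\<pi> \<in> couplings V \<mu> \<nu>"
    and feasible: "\<And>u v. \<lbrakk>u \<in> V; v \<in> V; \<mu> u \<noteq> 0; \<nu> v \<noteq> 0\<rbrakk>
      \<Longrightarrow> F u - G v \<le> real (graph_dist V E u v)"
    and tight: "\<And>u v. \<lbrakk>u \<in> V; v \<in> V; \<pi> u v \<noteq> 0\<rbrakk> \<Longrightarrow> real (graph_dist V E u v) \<le> F u - G v"
  shows "W1 V E \<mu> \<nu> = (\<Sum>u\<in>V. F u * \<mu> u) - (\<Sum>v\<in>V. G v * \<nu> v)"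
proof -
  define cost where "cost \<pi> = (\<Sum>u\<in>V. \<Sum>v\<in>V. real (graph_dist V E u v) * \<pi> u v)" for \<pi>
  define c where "c = (\<Sum>u\<in>V. F u * \<mu> u) - (\<Sum>v\<in>V. G v * \<nu> v)"
  have lower: "c \<le> cost \<sigma>" if \<sigma>: "\<sigma> \<in> couplings V \<mu> \<nu>" for \<sigma>
    unfolding c_def sum_coupling_potentials[OF V \<sigma>, symmetric] cost_def
  proof (intro sum_mono)
    fix u v assume uv: "u \<in> V" "v \<in> V"
    have nonneg: "\<And>u v. \<lbrakk>u \<in> V; v \<in> V\<rbrakk> \<Longrightarrow> 0 \<le> \<sigma> u v"
      and row: "(\<Sum>v\<in>V. \<sigma> u v) = \<mu> u" and col: "(\<Sum>u\<in>V. \<sigma> u v) = \<nu> v"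
      using \<sigma> uv by (auto simp: couplings_def)
    show "(F u - G v) * \<sigma> u v \<le> real (graph_dist V E u v) * \<sigma> u v"
    proof (cases "\<sigma> u v = 0")
      case False
      then have pos: "0 < \<sigma> u v"
        using nonneg[OF uv] by simp
      have "\<sigma> u v \<le> \<mu> u"
        unfolding row[symmetric] using uv V nonneg by (intro member_le_sum) auto
      moreover have "\<sigma> u v \<le> \<nu> v"
        unfolding col[symmetric]
        using uv V nonneg by (intro member_le_sum[where f = "\<lambda>u. \<sigma> u v"]) auto
      ultimately have "F u - G v \<le> real (graph_dist V E u v)"
        using pos uv by (intro feasible) auto
      then show ?thesis
        using pos by (intro mult_right_mono) auto
    qed simp
  qed
  have "cost \<pi> \<le> c"
    unfolding c_def sum_coupling_potentials[OF V \<pi>, symmetric] cost_def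
  proof (intro sum_mono)
    fix u v assume uv: "u \<in> V" "v \<in> V"
    show "real (graph_dist V E u v) * \<pi> u v \<le> (F u - G v) * \<pi> u v"
    proof (cases "\<pi> u v = 0")
      case False
      moreover have "0 \<le> \<pi> u v"
        using \<pi> uv by (simp add: couplings_def)
      ultimately show ?thesis
        using tight uv by (intro mult_right_mono) auto
    qed simp
  qed
  then have "c \<in> cost ` couplings V \<mu> \<nu>"
    using lower[OF \<pi>] \<pi> by (intro rev_image_eqI[of \<pi>]) auto
  then have "Inf (cost ` couplings V \<mu> \<nu>) = c"
    using lower by (intro cInf_eq_minimum) auto
  then show ?thesis
    by (simp add: W1_def cost_def c_def)
qed

section \<open>Distances in graphs of girth at least six\<close>

locale girth_six_graph =
  fixes V :: "'a set" and E :: "'a set set"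
  assumes simple: "simple_graph V E"
    and connected: "connected_graph V E"
    and girth: "6 \<le> girth V E"
begin

lemma finite_V: "finite V"
  using simple by (simp add: simple_graph_def)

lemma edge_vertices:
  assumes "{x, y} \<in> E"
  shows "x \<in> V \<and> y \<in> V \<and> x \<noteq> y"
proof -
  have "{x, y} \<subseteq> V \<and> card {x, y} = 2"
    using assms simple unfolding simple_graph_def by blast
  then show ?thesis
    by (auto simp: card_insert_if split: if_splits)
qed

lemma finite_E: "finite E"
proof (rule finite_subset)
  show "E \<subseteq> Pow V"
    using simple by (auto simp: simple_graph_def)
qed (simp add: finite_V)

lemma edge_doubleton:
  assumes "e \<in> E"
  shows "\<exists>x y. e = {x, y}"
proof -
  have "card e = 2"
    using assms simple by (simp add: simple_graph_def)
  then show ?thesis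
    by (auto simp: card_2_iff)
qed

lemma cycle_length:
  assumes "graph_cycle V E c"
  shows "6 \<le> length c"
proof -
  have "girth V E \<le> enat (length c)"
    unfolding girth_def using assms by (intro INF_lower) simp
  then have "6 \<le> enat (length c)"
    using girth by (rule order_trans[rotated])
  then show ?thesis
    by (simp add: numeral_eq_enat)
qed

lemma no_triangle:
  assumes "{a, b} \<in> E" "{b, c} \<in> E" "{c, a} \<in> E"
  shows False
proof -
  have "graph_cycle V E [a, b, c]"
    using assms assms[THEN edge_vertices] by (auto simp: graph_cycle_def)
  then show False
    using cycle_length by fastforce
qed

lemma no_square:
  assumes "{a, b} \<in> E" "{b, c} \<in> E" "{c, d} \<in> E" "{d, a} \<in> E" "a \<noteq> c" "b \<noteq> d"
  shows False
proof -
  have "graph_cycle V E [a, b, c, d]"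
    using assms assms(1-4)[THEN edge_vertices] by (auto simp: graph_cycle_def)
  then show False
    using cycle_length by fastforce
qed

lemma no_pentagon:
  assumes "{a, b} \<in> E" "{b, c} \<in> E" "{c, d} \<in> E" "{d, e} \<in> E" "{e, a} \<in> E"
  shows False
proof -
  have "a \<noteq> c" "b \<noteq> d" "c \<noteq> e" "d \<noteq> a" "e \<noteq> b"
    using assms no_triangle by blast+
  then have "graph_cycle V E [a, b, c, d, e]"
    using assms assms[THEN edge_vertices] by (auto simp: graph_cycle_def)
  then show False
    using cycle_length by fastforce
qed

lemma graph_dist_le:
  assumes "walk V E u p v" "length p = Suc n"
  shows "graph_dist V E u v \<le> n"
  unfolding graph_dist_def using assms by (intro Least_le) blast

lemma shortest_walk:
  assumes "u \<in> V" "v \<in> V"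
  shows "\<exists>p. walk V E u p v \<and> length p = Suc (graph_dist V E u v)"
proof -
  obtain p where p: "walk V E u p v"
    using connected assms by (auto simp: connected_graph_def)
  then have "length p = Suc (length p - 1)"
    by (simp add: walk_def)
  then have "\<exists>n p. walk V E u p v \<and> length p = Suc n"
    using p by blast
  then show ?thesis
    unfolding graph_dist_def by (rule LeastI_ex)
qed

lemma graph_dist_ge_1:
  assumes "u \<in> V" "v \<in> V" "u \<noteq> v"
  shows "1 \<le> graph_dist V E u v"
proof (rule ccontr)
  assume "\<not> ?thesis"
  then obtain p where "walk V E u p v" "length p = Suc 0"
    using shortest_walk[OF assms(1,2)] by auto
  then show False
    using assms(3) by (auto simp: walk_def length_Suc_conv)
qed

lemma graph_dist_ge_2:
  assumes "u \<in> V" "v \<in> V" "u \<noteq> v" "{u, v} \<notin> E"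
  shows "2 \<le> graph_dist V E u v"
proof (rule ccontr)
  assume "\<not> ?thesis"
  then have "graph_dist V E u v = 1"
    using graph_dist_ge_1[OF assms(1-3)] by simp
  then obtain p where "walk V E u p v" "length p = Suc (Suc 0)"
    using shortest_walk[OF assms(1,2)] by auto
  then show False
    using assms(4) by (auto simp: walk_def length_Suc_conv)
qed

lemma graph_dist_ge_3:
  assumes "u \<in> V" "v \<in> V" "u \<noteq> v" "{u, v} \<notin> E" "\<And>t. {u, t} \<in> E \<Longrightarrow> {t, v} \<in> E \<Longrightarrow> False"
  shows "3 \<le> graph_dist V E u v"
proof (rule ccontr)
  assume "\<not> ?thesis"
  then have "graph_dist V E u v = 2"
    using graph_dist_ge_2[OF assms(1-4)] by simp
  then obtain p where "walk V E u p v" "length p = Suc (Suc (Suc 0))"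
    using shortest_walk[OF assms(1,2)] by auto
  then show False
    using assms(5) by (auto simp: walk_def length_Suc_conv)
qed

lemma graph_dist_self: "u \<in> V \<Longrightarrow> graph_dist V E u u = 0"
  using graph_dist_le[of u "[u]" u 0] by (simp add: walk_def)

lemma graph_dist_edge: "{u, v} \<in> E \<Longrightarrow> graph_dist V E u v \<le> 1"
  using graph_dist_le[of u "[u, v]" v 1] edge_vertices[of u v] by (simp add: walk_def)

lemma graph_dist_two_edges: "\<lbrakk>{u, t} \<in> E; {t, v} \<in> E\<rbrakk> \<Longrightarrow> graph_dist V E u v \<le> 2"
  using graph_dist_le[of u "[u, t, v]" v 2] edge_vertices[of u t] edge_vertices[of t v]
  by (simp add: walk_def)

section \<open>The curvature of an edge\<close>

lemma neighbour_sum: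
  "(\<Sum>z | {x, z} \<in> E. g {x, z}) = (\<Sum>e\<in>{e \<in> E. x \<in> e}. g e)"
proof (rule sum.reindex_bij_betw, rule bij_betw_imageI)
  show "inj_on (\<lambda>z. {x, z}) {z. {x, z} \<in> E}"
    by (rule inj_onI) (auto simp: doubleton_eq_iff)
  have "e \<in> (\<lambda>z. {x, z}) ` {z. {x, z} \<in> E}" if e: "e \<in> E" "x \<in> e" for e
  proof -
    obtain a b where "e = {a, b}"
      using edge_doubleton[OF e(1)] by blast
    then have "e = {x, a} \<or> e = {x, b}"
      using e(2) by auto
    then obtain z where "e = {x, z}"
      by blast
    then show ?thesis
      using e(1) by simp
  qed
  then show "(\<lambda>z. {x, z}) ` {z. {x, z} \<in> E} = {e \<in> E. x \<in> e}"
    by auto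
qed

lemma weighted_degree_eq: "weighted_degree E w x = incident_weight E w x"
  unfolding weighted_degree_def incident_weight_def by (rule neighbour_sum)

lemma weighted_degree_pos:
  assumes "positive_weight E w" "{x, y} \<in> E"
  shows "0 < weighted_degree E w x"
  unfolding weighted_degree_eq incident_weight_def
  by (rule sum_pos) (use assms finite_E in \<open>auto simp: positive_weight_def\<close>)

lemma sum_lazy_measure:
  assumes w: "positive_weight E w" and xy: "{x, y} \<in> E"
  shows "(\<Sum>z\<in>V. lazy_measure E w \<alpha> x z) = 1"
proof -
  have x: "x \<in> V"
    using edge_vertices[OF xy] by blast
  have "(\<Sum>z\<in>V. lazy_measure E w \<alpha> x z) = \<alpha> + (\<Sum>z\<in>V - {x}. lazy_measure E w \<alpha> x z)"
    using finite_V x by (simp add: sum.remove[where x = x] lazy_measure_def)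
  also have "(\<Sum>z\<in>V - {x}. lazy_measure E w \<alpha> x z)
      = (\<Sum>z | {x, z} \<in> E. (1 - \<alpha>) * w {x, z} / weighted_degree E w x)"
    by (rule sum.mono_neutral_cong_right)
      (use finite_V edge_vertices in \<open>auto simp: lazy_measure_def\<close>)
  also have "\<dots> = (1 - \<alpha>) * weighted_degree E w x / weighted_degree E w x"
    by (simp add: weighted_degree_def sum_distrib_left sum_divide_distrib)
  also have "\<dots> = 1 - \<alpha>"
    using weighted_degree_pos[OF w xy] by simp
  finally show ?thesis
    by simp
qed

text \<open>The mass that \<open>x\<close> sends to its neighbours other than \<open>y\<close> moves to \<open>y\<close>, and \<open>x\<close> supplies the
neighbours of \<open>y\<close>. Mass on \<open>y\<close> and mass to be kept on \<open>x\<close> stay in place, and the remaining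
\<open>2 * \<alpha> - 1\<close> moves along the edge. That amount is nonnegative once \<open>\<alpha> \<ge> 1 / 2\<close>.\<close>

lemma edge_coupling:
  assumes w: "positive_weight E w" and xy: "{x, y} \<in> E" and \<alpha>: "1 / 2 \<le> \<alpha>" "\<alpha> < 1"
  shows "(\<lambda>u v. if v = y then if u = x then 2 * \<alpha> - 1 else lazy_measure E w \<alpha> x u
      else if u = x then lazy_measure E w \<alpha> y v else 0)
    \<in> couplings V (lazy_measure E w \<alpha> x) (lazy_measure E w \<alpha> y)"
proof -
  define \<mu> \<nu> where "\<mu> = lazy_measure E w \<alpha> x" and "\<nu> = lazy_measure E w \<alpha> y"
  have yx: "{y, x} \<in> E"
    using xy by (simp add: insert_commute)
  note V = edge_vertices[OF xy]
  have mass: "(\<Sum>z\<in>V. \<mu> z) = 1" "(\<Sum>z\<in>V. \<nu> z) = 1"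
    unfolding \<mu>_def \<nu>_def using sum_lazy_measure[OF w xy] sum_lazy_measure[OF w yx] by auto
  have diag: "\<mu> x = \<alpha>" "\<nu> y = \<alpha>"
    by (auto simp: \<mu>_def \<nu>_def lazy_measure_def)
  then have rest: "(\<Sum>z\<in>V - {x}. \<mu> z) = 1 - \<alpha>" "(\<Sum>z\<in>V - {y}. \<nu> z) = 1 - \<alpha>"
    using mass V finite_V by (auto simp: sum_diff1)
  have nonneg: "0 \<le> lazy_measure E w \<alpha> a z" if "{a, b} \<in> E" for a b z
    using weighted_degree_pos[OF w that] w \<alpha>
    by (auto simp: lazy_measure_def positive_weight_def less_imp_le)
  define \<pi> where "\<pi> = (\<lambda>u v. if v = y then if u = x then 2 * \<alpha> - 1 else \<mu> u
    else if u = x then \<nu> v else 0)"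
  have "0 \<le> \<pi> u v" for u v
    using nonneg[OF xy] nonneg[OF yx] \<alpha> by (simp add: \<pi>_def \<mu>_def \<nu>_def)
  moreover have "(\<Sum>v\<in>V. \<pi> u v) = \<mu> u" if "u \<in> V" for u
  proof -
    have "(\<Sum>v\<in>V. \<pi> u v) = \<pi> u y + (\<Sum>v\<in>V - {y}. \<pi> u v)"
      using V finite_V by (intro sum.remove) auto
    also have "(\<Sum>v\<in>V - {y}. \<pi> u v) = (\<Sum>v\<in>V - {y}. if u = x then \<nu> v else 0)"
      by (rule sum.cong) (auto simp: \<pi>_def)
    finally show ?thesis
      using rest diag by (auto simp: \<pi>_def)
  qed
  moreover have "(\<Sum>u\<in>V. \<pi> u v) = \<nu> v" if "v \<in> V" for v
  proof -
    have "(\<Sum>u\<in>V. \<pi> u v) = \<pi> x v + (\<Sum>u\<in>V - {x}. \<pi> u v)"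
      using V finite_V by (intro sum.remove) auto
    also have "(\<Sum>u\<in>V - {x}. \<pi> u v) = (\<Sum>u\<in>V - {x}. if v = y then \<mu> u else 0)"
      by (rule sum.cong) (auto simp: \<pi>_def)
    finally show ?thesis
      using rest diag by (auto simp: \<pi>_def)
  qed
  ultimately have "\<pi> \<in> couplings V \<mu> \<nu>"
    by (simp add: couplings_def)
  then show ?thesis
    by (simp only: \<pi>_def \<mu>_def \<nu>_def)
qed

lemma lazy_measure_support:
  assumes "lazy_measure E w \<alpha> x u \<noteq> 0"
  shows "u = x \<or> {x, u} \<in> E"
  using assms by (auto simp: lazy_measure_def split: if_splits)

text \<open>The potential \<open>F\<close> has the values \<open>2, 1, 0\<close> on the other neighbours of \<open>x\<close>, on \<open>x\<close> and on \<open>y\<close>, while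
\<open>G\<close> has the values \<open>1, 0, -1\<close> on \<open>x\<close>, on \<open>y\<close> and on the other neighbours of \<open>y\<close>: the position along
the path through \<open>x\<close> and \<open>y\<close>. Feasibility between the two groups of neighbours says that their
distance is at least three, which is where cycles of length three, four and five are excluded.\<close>

lemma W1_edge:
  assumes w: "positive_weight E w" and xy: "{x, y} \<in> E" and \<alpha>: "1 / 2 \<le> \<alpha>" "\<alpha> < 1"
  shows "W1 V E (lazy_measure E w \<alpha> x) (lazy_measure E w \<alpha> y)
    = 3 - 2 * \<alpha> - 2 * (1 - \<alpha>) * load E w {x, y}"
proof -
  define \<mu> \<nu> where "\<mu> = lazy_measure E w \<alpha> x" and "\<nu> = lazy_measure E w \<alpha> y"
  define F G :: "'a \<Rightarrow> real"
    where "F u = 2 - (if u = x then 1 else 0) - (if u = y then 2 else 0)"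
      and "G u = (if u = y then 1 else 0) + (if u = x then 2 else 0) - 1" for u
  have yx: "{y, x} \<in> E"
    using xy by (simp add: insert_commute)
  note V = edge_vertices[OF xy]
  have "W1 V E \<mu> \<nu> = (\<Sum>u\<in>V. F u * \<mu> u) - (\<Sum>v\<in>V. G v * \<nu> v)"
  proof (rule W1_eq_by_complementary_slackness[OF finite_V])
    show "(\<lambda>u v. if v = y then if u = x then 2 * \<alpha> - 1 else \<mu> u else if u = x then \<nu> v else 0)
        \<in> couplings V \<mu> \<nu>"
      unfolding \<mu>_def \<nu>_def by (rule edge_coupling[OF w xy \<alpha>])
  next
    fix u v assume uv: "u \<in> V" "v \<in> V" and "\<mu> u \<noteq> 0" "\<nu> v \<noteq> 0"
    then have u: "u = x \<or> u = y \<or> ({x, u} \<in> E \<and> u \<noteq> x \<and> u \<noteq> y)"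
      and v: "v = y \<or> v = x \<or> ({y, v} \<in> E \<and> v \<noteq> x \<and> v \<noteq> y)"
      using lazy_measure_support unfolding \<mu>_def \<nu>_def by metis+
    have zy: "2 \<le> graph_dist V E u y" if "{x, u} \<in> E" "u \<noteq> y"
      using that uv V no_triangle[of x u y] yx by (intro graph_dist_ge_2) auto
    have xz: "2 \<le> graph_dist V E x v" if "{y, v} \<in> E" "v \<noteq> x"
      using that uv V no_triangle[of y v x] xy by (intro graph_dist_ge_2) (auto simp: insert_commute)
    have zz: "3 \<le> graph_dist V E u v" if z: "{x, u} \<in> E" "u \<noteq> y" and z': "{y, v} \<in> E" "v \<noteq> x"
    proof (rule graph_dist_ge_3[OF uv])
      show "u \<noteq> v"
        using no_triangle[of x u y] z z' yx by (auto simp: insert_commute)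
      show "{u, v} \<notin> E"
        using no_square[of x u v y] z z' yx by (auto simp: insert_commute)
      show False if "{u, t} \<in> E" "{t, v} \<in> E" for t
        using no_pentagon[of x u t v y] z(1) z'(1) yx that by (auto simp: insert_commute)
    qed
    have d1: "1 \<le> graph_dist V E u v" if "u \<noteq> v"
      using graph_dist_ge_1[OF uv that] .
    show "F u - G v \<le> real (graph_dist V E u v)"
      using u v V zy xz zz d1 by (elim disjE conjE) (auto simp: F_def G_def)
  next
    fix u v assume uv: "u \<in> V" "v \<in> V"
      and nz: "(if v = y then if u = x then 2 * \<alpha> - 1 else \<mu> u else if u = x then \<nu> v else 0) \<noteq> 0"
    consider "u = x" "v = y" | "u \<noteq> x" "v = y" "\<mu> u \<noteq> 0" | "u = x" "v \<noteq> y" "\<nu> v \<noteq> 0"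
      using nz by (auto split: if_splits)
    then show "real (graph_dist V E u v) \<le> F u - G v"
    proof cases
      case 1
      then show ?thesis
        using graph_dist_edge[OF xy] V by (auto simp: F_def G_def)
    next
      case 2
      then have "{u, x} \<in> E"
        using lazy_measure_support[of w \<alpha> x u] by (simp add: \<mu>_def insert_commute)
      then show ?thesis
        using 2 V graph_dist_two_edges[of u x y] xy graph_dist_self[of y]
        by (auto simp: F_def G_def)
    next
      case 3
      then have "{y, v} \<in> E"
        using lazy_measure_support[of w \<alpha> y v] by (simp add: \<nu>_def)
      then show ?thesis
        using 3 V graph_dist_two_edges[of x y v] xy graph_dist_self[of x]
        by (auto simp: F_def G_def)
    qed
  qed
  also have "(\<Sum>u\<in>V. F u * \<mu> u)
      = (\<Sum>u\<in>V. 2 * \<mu> u - (if u = x then \<mu> x else 0) - (if u = y then 2 * \<mu> y else 0))"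
    using V by (intro sum.cong) (auto simp: F_def)
  also have "\<dots> = 2 - \<mu> x - 2 * \<mu> y"
    using V finite_V sum_lazy_measure[OF w xy, of \<alpha>]
    by (simp add: sum_subtractf \<mu>_def flip: sum_distrib_left)
  also have "(\<Sum>v\<in>V. G v * \<nu> v)
      = (\<Sum>v\<in>V. (if v = y then \<nu> y else 0) + (if v = x then 2 * \<nu> x else 0) - \<nu> v)"
    using V by (intro sum.cong) (auto simp: G_def)
  also have "\<dots> = \<nu> y + 2 * \<nu> x - 1"
    using V finite_V sum_lazy_measure[OF w yx, of \<alpha>]
    by (simp add: sum_subtractf sum.distrib \<nu>_def)
  also have "2 - \<mu> x - 2 * \<mu> y - (\<nu> y + 2 * \<nu> x - 1)
      = 3 - 2 * \<alpha> - 2 * (1 - \<alpha>) * load E w {x, y}"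
    using V V[THEN conjunct2, THEN conjunct2, symmetric] xy yx
    by (simp add: \<mu>_def \<nu>_def lazy_measure_def load_def weighted_degree_eq insert_commute
        algebra_simps)
  finally show ?thesis
    by (simp add: \<mu>_def \<nu>_def)
qed

text \<open>The quotient in the definition of the curvature is constant for \<open>\<alpha> > 1 / 2\<close>.\<close>

lemma kappa_LLY_edge:
  assumes w: "positive_weight E w" and xy: "{x, y} \<in> E"
  shows "kappa_LLY V E w x y = 2 * load E w {x, y} - 2"
proof -
  have "kappa V E w \<alpha> x y / (1 - \<alpha>) = 2 * load E w {x, y} - 2" if "\<alpha> \<in> {1 / 2<..<1}" for \<alpha>
  proof -
    have "kappa V E w \<alpha> x y = (1 - \<alpha>) * (2 * load E w {x, y} - 2)"
      using W1_edge[OF w xy, of \<alpha>] that by (simp add: kappa_def algebra_simps)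
    then show ?thesis
      using that by simp
  qed
  then have "eventually (\<lambda>\<alpha>. kappa V E w \<alpha> x y / (1 - \<alpha>) = 2 * load E w {x, y} - 2) (at_left 1)"
    using eventually_at_left_real[of "1 / 2" "1 :: real"] by (auto elim: eventually_mono)
  then show ?thesis
    unfolding kappa_LLY_def by (intro tendsto_Lim tendsto_eventually) simp
qed

section \<open>Strict balance and the maximal curvature\<close>

lemma vertices_eq_Union:
  assumes "E \<noteq> {}"
  shows "\<Union>E = V"
proof
  show "\<Union>E \<subseteq> V"
    using simple by (auto simp: simple_graph_def)
  show "V \<subseteq> \<Union>E"
  proof
    fix x assume x: "x \<in> V"
    obtain a b where "{a, b} \<in> E"
      using assms edge_doubleton by (metis ex_in_conv)
    then obtain y where y: "y \<in> V" "y \<noteq> x"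
      using edge_vertices by metis
    obtain p where p: "walk V E x p y"
      using connected x y by (auto simp: connected_graph_def)
    then obtain z q where "p = x # z # q"
      using y(2) by (cases p rule: remdups_adj.cases) (auto simp: walk_def)
    then have "{x, z} \<in> E"
      using p by (simp add: walk_def)
    then show "x \<in> \<Union>E"
      by blast
  qed
qed

lemma walk_stays_inside:
  assumes "successively (\<lambda>u v. {u, v} \<in> E) p" "p \<noteq> []" "hd p \<in> U"
    and closed: "\<And>e. e \<in> E \<Longrightarrow> e \<inter> U \<noteq> {} \<Longrightarrow> e \<subseteq> U"
  shows "last p \<in> U"
  using assms(1-3)
proof (induction p rule: induct_list012)
  case (3 a b p)
  then have "b \<in> U"
    using closed[of "{a, b}"] by auto
  then show ?case
    using 3 by simp
qed auto

text \<open>If no edge of \<open>F\<close> met an edge outside, a walk that starts at a vertex of \<open>F\<close> could never leave the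
vertices of \<open>F\<close>.\<close>

lemma crossing_edges:
  assumes F: "F \<subseteq> E" "F \<noteq> {}" "F \<noteq> E"
  shows "\<exists>e\<in>F. \<exists>f\<in>E - F. e \<inter> f \<noteq> {}"
proof (rule ccontr)
  assume none: "\<not> ?thesis"
  obtain f where f: "f \<in> E" "f \<notin> F"
    using F by blast
  obtain e where e: "e \<in> F"
    using F by blast
  obtain x where x: "x \<in> e" "x \<in> V"
    using edge_doubleton[of e] edge_vertices e F(1) by (metis insertI1 subsetD)
  obtain y where y: "y \<in> f" "y \<in> V"
    using edge_doubleton[of f] edge_vertices f by (metis insertI1)
  obtain p where p: "walk V E x p y"
    using connected x y by (auto simp: connected_graph_def)
  have closed: "g \<subseteq> \<Union>F" if "g \<in> E" "g \<inter> \<Union>F \<noteq> {}" for g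
    using none that by blast
  have "last p \<in> \<Union>F"
  proof (rule walk_stays_inside)
    show "successively (\<lambda>u v. {u, v} \<in> E) p" "p \<noteq> []"
      using p by (auto simp: walk_def)
    show "hd p \<in> \<Union>F"
      using p x(1) e by (auto simp: walk_def)
  qed (rule closed)
  then have "y \<in> \<Union>F"
    using p by (simp add: walk_def)
  then show False
    using none f y by blast
qed

lemma connected_hypergraph:
  assumes "E \<noteq> {}"
  shows "connected_hypergraph E"
proof
  fix e assume "e \<in> E"
  then show "finite e" "e \<noteq> {}"
    using edge_doubleton by force+
qed (use assms finite_E crossing_edges in auto)

text \<open>The density condition needs to be checked only on subgraphs without isolated vertices, which are given
by their edges: dropping isolated vertices does not lower the density of a subgraph with an edge. A
proper subgraph cannot contain all edges, since every vertex of \<open>V\<close> lies on an edge.\<close>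

lemma strictly_balanced_iff:
  assumes ne: "E \<noteq> {}"
  shows "strictly_balanced V E \<longleftrightarrow>
    (\<forall>F. F \<subseteq> E \<and> F \<noteq> {} \<and> F \<noteq> E \<longrightarrow> card (\<Union>E) * card F < card (\<Union>F) * card E)"
    (is "_ \<longleftrightarrow> ?edges")
proof -
  interpret connected_hypergraph E
    by (rule connected_hypergraph[OF ne])
  have V: "\<Union>E = V"
    by (rule vertices_eq_Union[OF ne])
  have density_less_iff: "real (card F) / real (card U) < real (card E) / real (card V)
      \<longleftrightarrow> card V * card F < card U * card E" if "0 < card U" for F :: "'a set set" and U :: "'a set"
  proof -
    have "0 < card V"
      using card_vertices_pos[of E] ne V by simp
    then have "real (card F) / real (card U) < real (card E) / real (card V)
        \<longleftrightarrow> real (card V * card F) < real (card U * card E)"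
      using that by (simp add: field_simps)
    then show ?thesis
      by (simp only: of_nat_less_iff)
  qed
  show ?thesis
  proof
    assume sb: "strictly_balanced V E"
    show ?edges
    proof (intro allI impI, elim conjE)
      fix F assume F: "F \<subseteq> E" "F \<noteq> {}" "F \<noteq> E"
      have "simple_graph (\<Union>F) F"
        using F(1) simple finite_vertices[OF F(1)] by (auto simp: simple_graph_def)
      moreover have "\<Union>F \<subseteq> V"
        using F(1) V by blast
      moreover have pos: "0 < card (\<Union>F)"
        by (rule card_vertices_pos[OF F(1,2)])
      then have "\<Union>F \<noteq> {}"
        by (metis card.empty less_irrefl)
      ultimately have "real (card F) / real (card (\<Union>F)) < real (card E) / real (card V)"
        using sb F unfolding strictly_balanced_def by blast
      then show "card (\<Union>E) * card F < card (\<Union>F) * card E"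
        using density_less_iff[OF pos] V by simp
    qed
  next
    assume edges: ?edges
    show "strictly_balanced V E"
      unfolding strictly_balanced_def
    proof (intro allI impI, elim conjE)
      fix V' E' assume sg: "simple_graph V' E'" and sub: "V' \<subseteq> V" "E' \<subseteq> E"
        and proper: "V' \<noteq> {}" "(V', E') \<noteq> (V, E)"
      have cover: "\<Union>E' \<subseteq> V'" and fin: "finite V'"
        using sg by (auto simp: simple_graph_def)
      then have pos: "0 < card V'"
        using proper(1) by (simp add: card_gt_0_iff)
      have "E' \<noteq> E"
        using cover sub(1) proper(2) V by auto
      have "card V * card E' < card V' * card E"
      proof (cases "E' = {}")
        case True
        then show ?thesis
          using pos card_edges_pos by simp
      next
        case False
        then have "card V * card E' < card (\<Union>E') * card E"
          using edges sub(2) \<open>E' \<noteq> E\<close> V by blast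
        also have "\<dots> \<le> card V' * card E"
          using card_mono[OF fin cover] by simp
        finally show ?thesis .
      qed
      then show "real (card E') / real (card V') < real (card E) / real (card V)"
        using density_less_iff[OF pos] by simp
    qed
  qed
qed

lemma kappa_LLY_graph_eq:
  assumes ne: "E \<noteq> {}" and w: "positive_weight E w"
  shows "kappa_LLY_graph V E w = 2 * min_load E w - 2"
proof -
  have "{kappa_LLY V E w x y | x y. {x, y} \<in> E} = (\<lambda>e. 2 * load E w e - 2) ` E"
  proof (intro equalityI subsetI)
    fix k assume "k \<in> (\<lambda>e. 2 * load E w e - 2) ` E"
    then obtain e where e: "e \<in> E" "k = 2 * load E w e - 2"
      by blast
    then obtain x y where "e = {x, y}"
      using edge_doubleton by blast
    then show "k \<in> {kappa_LLY V E w x y | x y. {x, y} \<in> E}"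
      using e kappa_LLY_edge[OF w, of x y] by force
  next
    fix k assume "k \<in> {kappa_LLY V E w x y | x y. {x, y} \<in> E}"
    then show "k \<in> (\<lambda>e. 2 * load E w e - 2) ` E"
      using kappa_LLY_edge[OF w] by auto
  qed
  also have "\<dots> = (\<lambda>s. 2 * s - 2) ` load E w ` E"
    by (simp add: image_image)
  also have "Min \<dots> = 2 * Min (load E w ` E) - 2"
    using finite_E ne by (intro mono_Min_commute[symmetric]) (auto simp: mono_def)
  finally show ?thesis
    by (simp add: kappa_LLY_graph_def min_load_def)
qed

text \<open>By the formula for the curvature, attaining the maximal curvature means maximising the smallest load.\<close>

lemma attains_max_iff_constant_load:
  assumes ne: "E \<noteq> {}"
  shows "attains_max V E w
    \<longleftrightarrow> positive_weight E w \<and> (\<forall>e\<in>E. load E w e = card (\<Union>E) / card E)"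
proof -
  interpret connected_hypergraph E
    by (rule connected_hypergraph[OF ne])
  have eq: "kappa_LLY_graph V E w' = 2 * min_load E w' - 2" if "positive_weight E w'" for w'
    by (rule kappa_LLY_graph_eq[OF ne that])
  have "kappa_LLY_graph V E w = kappa_LLY_max V E
      \<longleftrightarrow> (\<forall>w'. positive_weight E w' \<longrightarrow> min_load E w' \<le> min_load E w)" (is "?attained \<longleftrightarrow> ?max")
    if w: "positive_weight E w"
  proof
    assume attained: ?attained
    show ?max
    proof (intro allI impI)
      fix w' assume w': "positive_weight E w'"
      have "bdd_above (kappa_LLY_graph V E ` {w. positive_weight E w})"
        by (rule bdd_aboveI2[where M = "2 * (card (\<Union>E) / card E) - 2"])
          (use eq min_load_le in fastforce)
      then have "kappa_LLY_graph V E w' \<le> kappa_LLY_max V E"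
        unfolding kappa_LLY_max_def using w' by (intro cSUP_upper) auto
      then show "min_load E w' \<le> min_load E w"
        using attained eq[OF w] eq[OF w'] by simp
    qed
  next
    assume max: ?max
    have "kappa_LLY_graph V E w' \<le> kappa_LLY_graph V E w" if "positive_weight E w'" for w'
      using max that eq[OF w] eq[OF that] by simp
    then show ?attained
      unfolding kappa_LLY_max_def using w by (intro cSup_eq_maximum[symmetric]) auto
  qed
  then show ?thesis
    using min_load_maximizer_iff unfolding attains_max_def by blast
qed

end

theorem theorem1p2:
  fixes V :: "'a set" and E :: "'a set set"
  assumes "simple_graph V E"
    and "connected_graph V E"
    and "E \<noteq> {}"
    and "girth V E \<ge> 6"
  shows "((\<exists>w. attains_max V E w) \<longleftrightarrow> strictly_balanced V E) \<and>
    (strictly_balanced V E \<longrightarrow>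
      (\<forall>w w'. attains_max V E w \<and> attains_max V E w' \<longrightarrow>
         (\<exists>c>0. \<forall>e\<in>E. w' e = c * w e)) \<and>
      (\<forall>w. attains_max V E w \<longrightarrow>
         (\<forall>x y. {x, y} \<in> E \<longrightarrow> kappa_LLY V E w x y = kappa_LLY_max V E)))"
proof -
  interpret girth_six_graph V E
    by unfold_locales (fact assms(1) assms(2) assms(4))+
  interpret connected_hypergraph E
    by (rule connected_hypergraph[OF assms(3)])
  note attains = attains_max_iff_constant_load[OF assms(3)]
  have existence: "(\<exists>w. attains_max V E w) \<longleftrightarrow> strictly_balanced V E"
  proof
    assume "\<exists>w. attains_max V E w"
    then obtain w where w: "positive_weight E w" "\<And>e. e \<in> E \<Longrightarrow> load E w e = card (\<Union>E) / card E"
      using attains by blast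
    then show "strictly_balanced V E"
      unfolding strictly_balanced_iff[OF assms(3)]
      using balanced_if_constant_load[OF w] by blast
  next
    assume "strictly_balanced V E"
    then have balanced: "card (\<Union>E) * card F < card (\<Union>F) * card E"
      if "F \<subseteq> E" "F \<noteq> {}" "F \<noteq> E" for F
      unfolding strictly_balanced_iff[OF assms(3)] using that by blast
    obtain w where "positive_weight E w" "\<And>e. e \<in> E \<Longrightarrow> load E w e = card (\<Union>E) / card E"
      using constant_load_exists[OF balanced] by blast
    then show "\<exists>w. attains_max V E w"
      using attains by blast
  qed
  have uniqueness: "\<exists>c>0. \<forall>e\<in>E. w' e = c * w e"
    if ww': "attains_max V E w" "attains_max V E w'" for w w'
  proof -
    have w: "positive_weight E w" "\<And>e. e \<in> E \<Longrightarrow> load E w e = card (\<Union>E) / card E"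
      and w': "positive_weight E w'" "\<And>e. e \<in> E \<Longrightarrow> load E w' e = card (\<Union>E) / card E"
      using ww' attains by blast+
    obtain r where "0 < r" "\<And>e. e \<in> E \<Longrightarrow> w' e = r * w e"
      using constant_load_unique[OF w w'] by blast
    then show ?thesis
      by blast
  qed
  have constant_curvature: "kappa_LLY V E w x y = kappa_LLY_max V E"
    if w: "attains_max V E w" and xy: "{x, y} \<in> E" for w x y
  proof -
    have pos: "positive_weight E w" and load: "\<And>e. e \<in> E \<Longrightarrow> load E w e = card (\<Union>E) / card E"
      using w attains by blast+
    have "min_load E w \<in> load E w ` E"
      unfolding min_load_def using finite_edges edges_nonempty by (intro Min_in) auto
    then have "load E w {x, y} = min_load E w"
      using load xy by auto
    then have "kappa_LLY V E w x y = kappa_LLY_graph V E w"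
      by (simp add: kappa_LLY_edge[OF pos xy] kappa_LLY_graph_eq[OF assms(3) pos])
    then show ?thesis
      using w by (simp add: attains_max_def)
  qed
  show ?thesis
    using existence uniqueness constant_curvature by blast
qed

end
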